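(* Let $g_\theta(x)=W_2\,\phi(W_1x+b_1)+b_2$ be a two-layer network with $W_1\in\mathbb{R}^{m\times d}$, $b_1\in\mathbb{R}^m$, $W_2\in\mathbb{R}^{k\times m}$, $b_2\in\mathbb{R}^k$ and $\phi:\mathbb{R}\to\mathbb{R}$ twice differentiable (applied coordinatewise). Let $w_j\in\mathbb{R}^d$ be the transposed $j$-th row of $W_1$, assumed nonzero, and $v_j\in\mathbb{R}^k$ the $j$-th column of $W_2$. Let $(x_t,c_t)\in\mathbb{R}^d\times\mathbb{R}^k$, $t=1,\dots,T$, be given, and set $H_t=\nabla_x^2\big(c_t^\top g_\theta(x)\big)\big|_{x=x_t}$, $u_j=w_j/\|w_j\|_2$, and $$\gamma_{t,j}=(c_t^\top v_j)\,\phi''(w_j^\top x_t+b_{1,j})\,\|w_j\|_2^2,\qquad \gamma_j=(\gamma_{1,j},\dots,\gamma_{T,j})^\top\in\mathbb{R}^T .$$ Let $\mathscr{H}\in\mathbb{R}^{d\times d\times T}$ be the third-order tensor whose $t$-th frontal slice is $H_t$. Then $$\mathscr{H}=\sum_{j=1}^m u_j\otimes u_j\otimes\gamma_j .$$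
   Context: The $t$-th frontal slice of a tensor $\mathscr{H}\in\mathbb{R}^{d\times d\times T}$ is the $d\times d$ matrix $(\mathscr{H}_{p,q,t})_{p,q}$. For vectors $a,b\in\mathbb{R}^d$, $e\in\mathbb{R}^T$, the tensor $a\otimes b\otimes e$ has entries $(a\otimes b\otimes e)_{p,q,t}=a_pb_qe_t$. *)

theory Defs
  imports "HOL-Analysis.Analysis"
begin

definition gradient :: "(real ^ 'd \<Rightarrow> real) \<Rightarrow> real ^ 'd \<Rightarrow> real ^ 'd" where
  "gradient f x = (\<chi> p. frechet_derivative f (at x) (axis p 1))"

text \<open>The Hessian is the Jacobian matrix of the gradient: entry p, q is the derivative in
  direction q of the p-th partial derivative.\<close>

definition hessian :: "(real ^ 'd \<Rightarrow> real) \<Rightarrow> real ^ 'd \<Rightarrow> real ^ 'd ^ 'd" where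
  "hessian f x = matrix (frechet_derivative (gradient f) (at x))"

definition two_layer ::
  "(real \<Rightarrow> real) \<Rightarrow> real ^ 'd ^ 'm \<Rightarrow> real ^ 'm \<Rightarrow> real ^ 'm ^ 'k \<Rightarrow> real ^ 'k
    \<Rightarrow> real ^ 'd \<Rightarrow> real ^ 'k" where
  "two_layer \<phi> W1 b1 W2 b2 x = W2 *v (\<chi> j. \<phi> ((W1 *v x + b1) $ j)) + b2"

text \<open>A tensor with d x d x T entries is a value of type \<open>real ^ 'T ^ 'd ^ 'd\<close>; its entry
  with indices p, q, t is \<open>X $ p $ q $ t\<close>.\<close>

definition frontal_slice :: "real ^ 'T ^ 'e ^ 'd \<Rightarrow> 'T \<Rightarrow> real ^ 'e ^ 'd" where
  "frontal_slice X t = (\<chi> p q. X $ p $ q $ t)"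

definition outer3 :: "real ^ 'd \<Rightarrow> real ^ 'e \<Rightarrow> real ^ 'T \<Rightarrow> real ^ 'T ^ 'e ^ 'd" where
  "outer3 a b e = (\<chi> p q t. a $ p * b $ q * e $ t)"

text \<open>Wherever the second derivative exists in the classical sense, \<open>hessian\<close> returns it
  (elsewhere \<open>frechet_derivative\<close> is unspecified).\<close>

lemma hessian_eqI:
  assumes f: "\<And>y. (f has_derivative (\<lambda>h. g y \<bullet> h)) (at y)"
    and g: "(g has_derivative (\<lambda>h. A *v h)) (at x)"
  shows "hessian f x = A"
proof -
  have "gradient f = g"
    by (simp add: fun_eq_iff gradient_def vec_eq_iff inner_axis
        frechet_derivative_at[OF f, symmetric])
  then show ?thesis
    by (simp add: hessian_def frechet_derivative_at[OF g, symmetric])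
qed

end

theory Submission
  imports Defs
begin

text \<open>Expanding the output layer along the columns of \<open>W2\<close> turns
  \<open>c \<bullet> two_layer ...\<close> into a constant plus a weighted sum of ridge functions,
  one per neuron (\<open>inner_two_layer\<close>). A ridge function varies only along its weight
  vector \<open>w j\<close>, so its Hessian is a scalar multiple of the rank-one matrix with entries
  \<open>w j $ p * w j $ q\<close> (\<open>hessian_ridge_sum\<close>). Writing \<open>w j\<close> as
  its norm times \<open>u j\<close> moves the squared norm into \<gamma>. The directions
  \<open>u j\<close> are the same for every sample \<open>t\<close>; only the scalars change, so the
  slices stack into a sum of rank-one tensors.\<close>

lemma inner_two_layer:
  fixes W1 :: "real ^ 'd ^ 'm" and W2 :: "real ^ 'm ^ 'k"
  shows "c \<bullet> two_layer \<phi> W1 b1 W2 b2 z =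
    (\<Sum>j\<in>UNIV. (c \<bullet> column j W2) * \<phi> (row j W1 \<bullet> z + b1 $ j)) + c \<bullet> b2"
  by (simp add: two_layer_def inner_add_right matrix_mult_sum[of W2] inner_sum_right
      matrix_vector_mul_component row_def mult.commute scalar_mult_eq_scaleR)

text \<open>Two applications of the one-dimensional chain rule, each producing a factor
  \<open>w j\<close>. The second derivative of \<phi> need not be continuous, as the gradient is
  differentiated as a vector-valued map.\<close>

lemma hessian_ridge_sum:
  fixes w :: "'m::finite \<Rightarrow> real ^ 'd" and \<alpha> b :: "'m \<Rightarrow> real"
  assumes \<phi>: "\<And>s. \<phi> differentiable (at s)"
    and \<phi>': "\<And>s. deriv \<phi> differentiable (at s)"
  shows "hessian (\<lambda>z. (\<Sum>j\<in>UNIV. \<alpha> j * \<phi> (w j \<bullet> z + b j)) + k) x =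
    (\<chi> p q. \<Sum>j\<in>UNIV. \<alpha> j * deriv (deriv \<phi>) (w j \<bullet> x + b j) * (w j $ p * w j $ q))"
    (is "_ = ?A")
proof (rule hessian_eqI)
  \<comment> \<open>Kept general in \<open>f\<close>, since it serves \<phi> for the gradient and
    \<open>deriv \<phi>\<close> for the Hessian.\<close>
  have *: "((\<lambda>z. f (w j \<bullet> z + b j)) has_derivative
      (\<lambda>h. deriv f (w j \<bullet> y + b j) * (w j \<bullet> h))) (at y)"
    if "\<And>s. f differentiable (at s)" for f :: "real \<Rightarrow> real" and j y
  proof -
    have "(f has_derivative (*) (deriv f (w j \<bullet> y + b j))) (at (w j \<bullet> y + b j))"
      using that by (simp add: DERIV_deriv_iff_real_differentiable flip: has_field_derivative_def)
    moreover have "((\<lambda>z. w j \<bullet> z + b j) has_derivative (\<lambda>h. w j \<bullet> h)) (at y)"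
      by (auto intro!: derivative_eq_intros)
    ultimately show ?thesis
      by (rule has_derivative_compose[rotated])
  qed
  show "((\<lambda>z. (\<Sum>j\<in>UNIV. \<alpha> j * \<phi> (w j \<bullet> z + b j)) + k) has_derivative
      (\<lambda>h. (\<Sum>j\<in>UNIV. (\<alpha> j * deriv \<phi> (w j \<bullet> y + b j)) *\<^sub>R w j) \<bullet> h)) (at y)" for y
    by (auto intro!: derivative_eq_intros *[OF \<phi>] simp: inner_sum_left mult.assoc)
  have "((\<lambda>y. \<Sum>j\<in>UNIV. (\<alpha> j * deriv \<phi> (w j \<bullet> y + b j)) *\<^sub>R w j) has_derivative
      (\<lambda>h. \<Sum>j\<in>UNIV. (\<alpha> j * (deriv (deriv \<phi>) (w j \<bullet> x + b j) * (w j \<bullet> h))) *\<^sub>R w j)) (at x)"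
    by (intro has_derivative_sum has_derivative_scaleR_left has_derivative_mult_right *[OF \<phi>'])
  \<comment> \<open>This is the identity (w . h) w = (w w^T) h summed over the neurons; in
    coordinates it comes down to exchanging the sums over \<open>j\<close> and
    \<open>q\<close>.\<close>
  moreover have "(\<lambda>h. \<Sum>j\<in>UNIV. (\<alpha> j * (deriv (deriv \<phi>) (w j \<bullet> x + b j) * (w j \<bullet> h))) *\<^sub>R w j) =
      (\<lambda>h. ?A *v h)"
  proof
    fix h
    have "(\<Sum>j\<in>UNIV. \<alpha> j * (deriv (deriv \<phi>) (w j \<bullet> x + b j) * (w j \<bullet> h)) * w j $ p) =
      (\<Sum>q\<in>UNIV. (\<Sum>j\<in>UNIV. \<alpha> j * deriv (deriv \<phi>) (w j \<bullet> x + b j) * (w j $ p * w j $ q)) * h $ q)"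
      for p
      unfolding sum_distrib_right inner_vec_def
      by (subst sum.swap) (simp add: sum_distrib_left sum_distrib_right mult_ac)
    then show "(\<Sum>j\<in>UNIV. (\<alpha> j * (deriv (deriv \<phi>) (w j \<bullet> x + b j) * (w j \<bullet> h))) *\<^sub>R w j) = ?A *v h"
      by (simp add: vec_eq_iff matrix_vector_mult_def)
  qed
  ultimately show "((\<lambda>y. \<Sum>j\<in>UNIV. (\<alpha> j * deriv \<phi> (w j \<bullet> y + b j)) *\<^sub>R w j) has_derivative
      (\<lambda>h. ?A *v h)) (at x)"
    by simp
qed

theorem proposition1:
  fixes W1 :: "real ^ 'd ^ 'm" and b1 :: "real ^ 'm"
    and W2 :: "real ^ 'm ^ 'k" and b2 :: "real ^ 'k"
    and \<phi> :: "real \<Rightarrow> real"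
    and w :: "'m \<Rightarrow> real ^ 'd" and v :: "'m \<Rightarrow> real ^ 'k"
    and x :: "'T::finite \<Rightarrow> real ^ 'd" and c :: "'T \<Rightarrow> real ^ 'k"
    and H :: "'T \<Rightarrow> real ^ 'd ^ 'd"
    and u :: "'m \<Rightarrow> real ^ 'd" and \<gamma> :: "'m \<Rightarrow> real ^ 'T"
    and \<H> :: "real ^ 'T ^ 'd ^ 'd"
  assumes "\<And>s. \<phi> differentiable (at s)"
    and "\<And>s. deriv \<phi> differentiable (at s)"
    and "\<And>j. w j = row j W1"
    and "\<And>j. w j \<noteq> 0"
    and "\<And>j. v j = column j W2"
    and "\<And>t. H t = hessian (\<lambda>z. c t \<bullet> two_layer \<phi> W1 b1 W2 b2 z) (x t)"
    and "\<And>j. u j = w j /\<^sub>R norm (w j)"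
    and "\<And>j t. \<gamma> j $ t =
      (c t \<bullet> v j) * deriv (deriv \<phi>) (w j \<bullet> x t + b1 $ j) * (norm (w j))\<^sup>2"
    and "\<And>t. frontal_slice \<H> t = H t"
  shows "\<H> = (\<Sum>j\<in>UNIV. outer3 (u j) (u j) (\<gamma> j))"
proof -
  have "\<H> $ p $ q $ t = (\<Sum>j\<in>UNIV. outer3 (u j) (u j) (\<gamma> j)) $ p $ q $ t" for p q t
  proof -
    have "\<H> $ p $ q $ t = H t $ p $ q"
      by (simp add: frontal_slice_def flip: assms(9))
    \<comment> \<open>The ridge coefficients are \<open>c t \<bullet> v j\<close>, and the additive
      constant is \<open>c t \<bullet> b2\<close>.\<close>
    also have "\<dots> = (\<Sum>j\<in>UNIV. (c t \<bullet> v j) * deriv (deriv \<phi>) (w j \<bullet> x t + b1 $ j) * (w j $ p * w j $ q))"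
      by (simp add: assms(6) inner_two_layer hessian_ridge_sum[OF assms(1,2)] flip: assms(3,5))
    \<comment> \<open>The two normalising factors in \<open>u j $ p * u j $ q\<close> cancel the
      squared norm in \<gamma>, which requires \<open>w j\<close> to be nonzero.\<close>
    also have "\<dots> = (\<Sum>j\<in>UNIV. u j $ p * u j $ q * \<gamma> j $ t)"
      using assms(4) by (intro sum.cong) (simp_all add: assms(7,8) power2_eq_square field_simps)
    finally show ?thesis
      by (simp add: outer3_def)
  qed
  then show ?thesis
    by (simp add: vec_eq_iff)
qed

end
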